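(* There exist a universal constant $C>0$ (large enough) and a universal constant $c>0$ (small enough) such that the following holds. For any algorithm in $\mathcal{A}_{det}\cup\mathcal{A}_{span}$, any integer $T>1$, and any integer $d\geq 2T$, there is a function $h:\mathbb{R}^d\to\mathbb{R}$ such that: (1) $h$ is $C$-Lipschitz (with respect to the Euclidean norm), and $h(\mathbf{0})-\inf_{\mathbf{x}\in\mathbb{R}^d}h(\mathbf{x})\leq C$. (2) When the algorithm is run on $h$, with probability at least $1-T\exp(-cd)$ over the algorithm's randomness (or deterministically, if the algorithm is deterministic), the iterates $\mathbf{x}_1,\ldots,\mathbf{x}_T$ it produces satisfy $$\inf_{\mathbf{x}\in\mathcal{S}}\ \min_{t\in\{1,\ldots,T\}}\|\mathbf{x}_t-\mathbf{x}\|\ \geq\ c,$$ where $\mathcal{S}$ is the set of $c$-stationary points of $h$.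
   Context: $\|\cdot\|$ is the Euclidean norm. Generalized gradients: for a Lipschitz function $f:\mathbb{R}^d\to\mathbb{R}$ (which is differentiable almost everywhere) and a point $\mathbf{x}$, the set of (Clarke) generalized gradients is $$\partial f(\mathbf{x}):=\mathrm{conv}\{\mathbf{u}:\ \mathbf{u}=\lim_{k\to\infty}\nabla f(\mathbf{x}_k),\ \mathbf{x}_k\to\mathbf{x}\},$$ i.e. the convex hull of all limits of $\nabla f(\mathbf{x}_k)$ over all sequences $(\mathbf{x}_k)$ of differentiability points of $f$ converging to $\mathbf{x}$ for which the limit exists. For $\epsilon\geq 0$, a point $\mathbf{x}$ is an $\epsilon$-stationary point of $f$ if there is some $\mathbf{u}\in\partial f(\mathbf{x})$ with $\|\mathbf{u}\|\leq\epsilon$. Oracle-based algorithms: with each Lipschitz, bounded-from-below function $f$ on $\mathbb{R}^d$ is associated an oracle which, for any query $\mathbf{x}\in\mathbb{R}^d$, returns the value $f(\mathbf{x})$ and a generalized gradient $\mathbf{g}\in\partial f(\mathbf{x})$. An oracle-based algorithm run on $f$ chooses at each iteration $t=1,2,\ldots$ an iterate $\mathbf{x}_t$, receives from the oracle the value $f(\mathbf{x}_t)$ and a generalized gradient $\mathbf{g}_t\in\partial f(\mathbf{x}_t)$, and uses the values and gradients obtained up to iteration $t$ (and possibly internal random coin flips, if the algorithm is randomized) to choose $\mathbf{x}_{t+1}$. The algorithm does not otherwise have access to $f$. $\mathcal{A}_{det}$ is the class of all deterministic oracle-based algorithms: $\mathbf{x}_1$ is chosen deterministically, and for all $t>1$,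 $\mathbf{x}_t$ is some deterministic function of $\mathbf{x}_1$ and the previously observed values and gradients. $\mathcal{A}_{span}$ is the class of all linear-span algorithms: all deterministic or randomized oracle-based algorithms that initialize at $\mathbf{x}_1=\mathbf{0}$ and satisfy $\mathbf{x}_t\in\mathrm{span}(\mathbf{g}_1,\ldots,\mathbf{g}_{t-1})$ for all $t>1$, where $\mathbf{g}_i$ is the gradient returned by the oracle at iteration $i$ for the query point $\mathbf{x}_i$. *)

theory Defs
  imports "HOL-Probability.Probability"
begin

text \<open>
  The constants of the statement are uniform in the dimension, so all spaces \<open>R^d\<close> must live in a
  single type.  The type \<open>rvec\<close> consists of the real sequences with finitely many nonzero
  coordinates, with the Euclidean inner product; \<open>R^d\<close> is the subspace \<open>Rn d\<close> of those sequences
  whose coordinates vanish from index \<open>d\<close> on.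
\<close>

typedef rvec = "{x :: nat \<Rightarrow> real. finite {i. x i \<noteq> 0}}"
  morphisms coord Abs_rvec
  by (rule exI[of _ "\<lambda>_. 0"]) simp

setup_lifting type_definition_rvec

lemma finite_coord [simp]: "finite {i. coord x i \<noteq> 0}"
  using coord[of x] by simp

instantiation rvec :: real_inner
begin

lift_definition zero_rvec :: rvec is "\<lambda>_. 0" by simp

lift_definition plus_rvec :: "rvec \<Rightarrow> rvec \<Rightarrow> rvec" is "\<lambda>x y i. x i + y i"
proof -
  fix x y :: "nat \<Rightarrow> real"
  assume "finite {i. x i \<noteq> 0}" "finite {i. y i \<noteq> 0}"
  then show "finite {i. x i + y i \<noteq> 0}"
    by (rule_tac finite_subset[of _ "{i. x i \<noteq> 0} \<union> {i. y i \<noteq> 0}"]) auto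
qed

lift_definition minus_rvec :: "rvec \<Rightarrow> rvec \<Rightarrow> rvec" is "\<lambda>x y i. x i - y i"
proof -
  fix x y :: "nat \<Rightarrow> real"
  assume "finite {i. x i \<noteq> 0}" "finite {i. y i \<noteq> 0}"
  then show "finite {i. x i - y i \<noteq> 0}"
    by (rule_tac finite_subset[of _ "{i. x i \<noteq> 0} \<union> {i. y i \<noteq> 0}"]) auto
qed

lift_definition uminus_rvec :: "rvec \<Rightarrow> rvec" is "\<lambda>x i. - x i" by simp

lift_definition scaleR_rvec :: "real \<Rightarrow> rvec \<Rightarrow> rvec" is "\<lambda>c x i. c * x i"
  by (rule finite_subset[rotated], assumption) auto

definition inner_rvec :: "rvec \<Rightarrow> rvec \<Rightarrow> real"
  where "inner_rvec x y = (\<Sum>i | coord x i \<noteq> 0. coord x i * coord y i)"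

definition norm_rvec :: "rvec \<Rightarrow> real"
  where "norm_rvec x = sqrt (inner x x)"

definition sgn_rvec :: "rvec \<Rightarrow> rvec"
  where "sgn_rvec x = inverse (norm x) *\<^sub>R x"

definition dist_rvec :: "rvec \<Rightarrow> rvec \<Rightarrow> real"
  where "dist_rvec x y = norm (x - y)"

definition uniformity_rvec :: "(rvec \<times> rvec) filter"
  where "uniformity_rvec = (INF e\<in>{0<..}. principal {(x, y). dist x y < e})"

definition open_rvec :: "rvec set \<Rightarrow> bool"
  where "open_rvec U \<longleftrightarrow> (\<forall>x\<in>U. \<forall>\<^sub>F (x', y) in uniformity. x' = x \<longrightarrow> y \<in> U)"

lemma inner_rvec_eq:
  assumes "finite I" "{i. coord x i \<noteq> 0} \<subseteq> I"
  shows "inner x y = (\<Sum>i\<in>I. coord x i * coord y i)"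
  unfolding inner_rvec_def using assms by (intro sum.mono_neutral_left) auto

instance
proof
  fix x y z :: rvec and a b :: real
  show "x + y + z = x + (y + z)" by transfer (simp add: add.assoc)
  show "x + y = y + x" by transfer (simp add: add.commute)
  show "0 + x = x" by transfer simp
  show "- x + x = 0" by transfer simp
  show "x - y = x + - y" by transfer simp
  show "a *\<^sub>R (x + y) = a *\<^sub>R x + a *\<^sub>R y" by transfer (simp add: algebra_simps)
  show "(a + b) *\<^sub>R x = a *\<^sub>R x + b *\<^sub>R x" by transfer (simp add: algebra_simps)
  show "a *\<^sub>R b *\<^sub>R x = (a * b) *\<^sub>R x" by transfer (simp add: algebra_simps)
  show "1 *\<^sub>R x = x" by transfer simp
  show "dist x y = norm (x - y)" by (rule dist_rvec_def)
  show "sgn x = inverse (norm x) *\<^sub>R x" by (rule sgn_rvec_def)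
  show "uniformity = (INF e\<in>{0<..}. principal {(x :: rvec, y). dist x y < e})"
    by (rule uniformity_rvec_def)
  show "open U \<longleftrightarrow> (\<forall>x\<in>U. \<forall>\<^sub>F (x', y) in uniformity. x' = x \<longrightarrow> y \<in> U)" for U :: "rvec set"
    by (rule open_rvec_def)
  show "norm x = sqrt (inner x x)" by (rule norm_rvec_def)
  define I where "I = {i. coord x i \<noteq> 0} \<union> {i. coord y i \<noteq> 0} \<union> {i. coord z i \<noteq> 0}"
  have fin: "finite I" by (simp add: I_def)
  have inn: "inner u v = (\<Sum>i\<in>I. coord u i * coord v i)" if "{i. coord u i \<noteq> 0} \<subseteq> I" for u v
    using fin that by (rule inner_rvec_eq)
  have sub: "{i. coord x i \<noteq> 0} \<subseteq> I" "{i. coord y i \<noteq> 0} \<subseteq> I"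
    "{i. coord (x + y) i \<noteq> 0} \<subseteq> I" "{i. coord (a *\<^sub>R x) i \<noteq> 0} \<subseteq> I"
    by (auto simp: I_def plus_rvec.rep_eq scaleR_rvec.rep_eq)
  show "inner x y = inner y x"
    by (simp add: inn sub mult.commute)
  show "inner (x + y) z = inner x z + inner y z"
    by (simp only: inn[OF sub(1)] inn[OF sub(2)] inn[OF sub(3)])
       (simp add: plus_rvec.rep_eq distrib_right sum.distrib)
  show "inner (a *\<^sub>R x) y = a * inner x y"
    by (simp only: inn[OF sub(1)] inn[OF sub(4)])
       (simp add: scaleR_rvec.rep_eq sum_distrib_left mult.assoc)
  show "0 \<le> inner x x"
    by (simp add: inner_rvec_def sum_nonneg)
  have "inner x x = 0 \<longleftrightarrow> (\<forall>i\<in>{i. coord x i \<noteq> 0}. coord x i * coord x i = 0)"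
    unfolding inner_rvec_def by (rule sum_nonneg_eq_0_iff) auto
  also have "\<dots> \<longleftrightarrow> coord x = (\<lambda>_. 0)" by auto
  also have "\<dots> \<longleftrightarrow> x = 0" by transfer simp
  finally show "inner x x = 0 \<longleftrightarrow> x = 0" .
qed

end

definition Rn :: "nat \<Rightarrow> rvec set"
  where "Rn d = {x. \<forall>i\<ge>d. coord x i = 0}"

text \<open>
  A function on \<open>R^d\<close> is represented by a function on \<open>rvec\<close> of which only the restriction to
  \<open>Rn d\<close> matters.
\<close>

definition has_gradient :: "nat \<Rightarrow> (rvec \<Rightarrow> real) \<Rightarrow> rvec \<Rightarrow> rvec \<Rightarrow> bool"
  where "has_gradient d f x u \<longleftrightarrow>
    u \<in> Rn d \<and> (f has_derivative (\<lambda>y. inner u y)) (at x within Rn d)"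

definition clarke :: "nat \<Rightarrow> (rvec \<Rightarrow> real) \<Rightarrow> rvec \<Rightarrow> rvec set"
  where "clarke d f x = convex hull
    {u. \<exists>X G. (\<forall>k::nat. X k \<in> Rn d \<and> has_gradient d f (X k) (G k)) \<and>
              X \<longlonglongrightarrow> x \<and> G \<longlonglongrightarrow> u}"

definition stationary_points :: "nat \<Rightarrow> real \<Rightarrow> (rvec \<Rightarrow> real) \<Rightarrow> rvec set"
  where "stationary_points d \<epsilon> f = {x \<in> Rn d. \<exists>u\<in>clarke d f x. norm u \<le> \<epsilon>}"

definition lipschitz_bdd_below :: "nat \<Rightarrow> (rvec \<Rightarrow> real) set"
  where "lipschitz_bdd_below d = {f. (\<exists>L. L-lipschitz_on (Rn d) f) \<and> bdd_below (f ` Rn d)}"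

text \<open>
  An oracle assignment: \<open>\<O> f x\<close> is the generalized gradient that the oracle associated with \<open>f\<close>
  returns for the query \<open>x\<close>; the value it returns is \<open>f x\<close>.
\<close>

definition oracles :: "nat \<Rightarrow> ((rvec \<Rightarrow> real) \<Rightarrow> rvec \<Rightarrow> rvec) set"
  where "oracles d = {\<O>. \<forall>f\<in>lipschitz_bdd_below d. \<forall>x\<in>Rn d. \<O> f x \<in> clarke d f x}"

type_synonym history = "(real \<times> rvec) list"

definition histories :: "nat \<Rightarrow> history set"
  where "histories d = lists (UNIV \<times> Rn d)"

text \<open>
  An algorithm \<open>(M, A)\<close> draws a random seed \<open>\<omega>\<close> from the probability space \<open>M\<close>; its next query is
  \<open>A \<omega> H\<close>, where \<open>H\<close> lists the answers received so far.  Seeds are taken in the fixed type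
  \<open>nat \<Rightarrow> real\<close>, so that no constant can depend on the type of seeds; \<open>M\<close> is an arbitrary
  probability measure there, e.g. that of a sequence of fair coin flips.
\<close>

type_synonym algorithm = "(nat \<Rightarrow> real) measure \<times> ((nat \<Rightarrow> real) \<Rightarrow> history \<Rightarrow> rvec)"

primrec answers :: "(history \<Rightarrow> rvec) \<Rightarrow> (rvec \<Rightarrow> real) \<Rightarrow> (rvec \<Rightarrow> rvec) \<Rightarrow> nat \<Rightarrow> history"
  where
    "answers a f g 0 = []"
  | "answers a f g (Suc t) =
      (let H = answers a f g t in H @ [(f (a H), g (a H))])"

text \<open>Iterates are numbered from 1; \<open>iter_pt a f g 0\<close> is not used.\<close>

definition iter_pt :: "(history \<Rightarrow> rvec) \<Rightarrow> (rvec \<Rightarrow> real) \<Rightarrow> (rvec \<Rightarrow> rvec) \<Rightarrow> nat \<Rightarrow> rvec"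
  where "iter_pt a f g t = a (answers a f g (t - 1))"

definition algorithms :: "nat \<Rightarrow> algorithm set"
  where "algorithms d = {(M, A). prob_space M \<and> (\<forall>\<omega>\<in>space M. \<forall>H\<in>histories d. A \<omega> H \<in> Rn d)}"

definition det_algorithms :: "nat \<Rightarrow> algorithm set"
  where "det_algorithms d =
    {(M, A) \<in> algorithms d. \<exists>a. \<forall>\<omega>\<in>space M. \<forall>H\<in>histories d. A \<omega> H = a H}"

text \<open>
  Randomized algorithms are jointly measurable in the seed and the answers, for each number \<open>n\<close>
  of answers, so that the iterates are random variables when the answers depend measurably on
  the queries.
\<close>

definition measurable_algorithm :: "nat \<Rightarrow> algorithm \<Rightarrow> bool"
  where "measurable_algorithm d = (\<lambda>(M, A). \<forall>n.
    (\<lambda>(\<omega>, y). A \<omega> (map y [0..<n])) \<in>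
      M \<Otimes>\<^sub>M (\<Pi>\<^sub>M i\<in>{..<n}. borel \<Otimes>\<^sub>M restrict_space borel (Rn d)) \<rightarrow>\<^sub>M borel)"

definition span_algorithms :: "nat \<Rightarrow> ((rvec \<Rightarrow> real) \<Rightarrow> rvec \<Rightarrow> rvec) \<Rightarrow> algorithm set"
  where "span_algorithms d \<O> =
    {(M, A) \<in> algorithms d. measurable_algorithm d (M, A) \<and>
      (\<forall>f\<in>lipschitz_bdd_below d. \<forall>\<omega>\<in>space M.
        let x = iter_pt (A \<omega>) f (\<O> f) in
          x 1 = 0 \<and> (\<forall>t>1. x t \<in> span ((\<lambda>i. \<O> f (x i)) ` {1..t - 1})))}"

end

(*
  Let v_0, ..., v_n (n = T - 1) be orthonormal and let N be the shift N v_i = v_{i+1} for i < n, with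
  N = 0 on v_n and on the orthogonal complement. The function base x = |x - N x / 2 - v_0| is a
  Euclidean norm, with constants between 1/2 and 3/2, of x - c, where c = sum_i 2^{-i} v_i. It is
  differentiable off c, and as in Nesterov's lower bound for quadratics each gradient reveals at most
  one new v_i, so that the first T iterates are orthogonal to v_n and never hit c. The only
  stationary point c of base is removed by subtracting a cone (spike) of slope 4 - 2 > 3/2 along v_n whose
  apex is slightly behind c, on the positive side of the hyperplane orthogonal to v_n: the iterates
  do not see it, the truncated function max (-1) (base - max 0 spike) is stationary only where it is
  -1, and it is nonnegative at the iterates, so the Lipschitz bound separates the two.
  For linear-span algorithms the v_i are standard basis vectors; for a deterministic algorithm v_t is
  chosen orthogonal to the iterates x_1, ..., x_{t+1} when these become known. Both cases hold for
  every seed, so the probability bound is trivial.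
*)
theory Submission
  imports Defs
begin

section \<open>The hard function\<close>

text \<open>The family \<open>v\<close> is arbitrary here and in the next definitions.
  Orthonormality is assumed only later, so a partly chosen chain padded with zero vectors still has
  a \<open>base\<close>.\<close>

definition chain_shift :: "(nat \<Rightarrow> 'a::real_inner) \<Rightarrow> nat \<Rightarrow> 'a \<Rightarrow> 'a"
  where "chain_shift v n x = (\<Sum>i<n. inner (v i) x *\<^sub>R v (Suc i))"

text \<open>The adjoint of \<open>chain_shift\<close> (see \<open>inner_shift\<close>). It enters
  through the gradient of the norm of the residual.\<close>

definition chain_coshift :: "(nat \<Rightarrow> 'a::real_inner) \<Rightarrow> nat \<Rightarrow> 'a \<Rightarrow> 'a"
  where "chain_coshift v n x = (\<Sum>i<n. inner (v (Suc i)) x *\<^sub>R v i)"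

definition residual :: "(nat \<Rightarrow> 'a::real_inner) \<Rightarrow> nat \<Rightarrow> 'a \<Rightarrow> 'a"
  where "residual v n x = x - (1/2) *\<^sub>R chain_shift v n x - v 0"

definition base :: "(nat \<Rightarrow> 'a::real_inner) \<Rightarrow> nat \<Rightarrow> 'a \<Rightarrow> real"
  where "base v n x = norm (residual v n x)"

definition base_grad :: "(nat \<Rightarrow> 'a::real_inner) \<Rightarrow> nat \<Rightarrow> 'a \<Rightarrow> 'a"
  where "base_grad v n x =
    (1 / base v n x) *\<^sub>R (residual v n x - (1/2) *\<^sub>R chain_coshift v n (residual v n x))"

definition center :: "(nat \<Rightarrow> 'a::real_inner) \<Rightarrow> nat \<Rightarrow> 'a"
  where "center v n = (\<Sum>i\<le>n. (1/2)^i *\<^sub>R v i)"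

text \<open>The \<open>v n\<close> component of the center is halved. What is left is positive, so
  the hyperplane orthogonal to \<open>v n\<close> lies behind the apex, while the center lies ahead
  of it, on the axis of the cone.\<close>

definition apex :: "(nat \<Rightarrow> 'a::real_inner) \<Rightarrow> nat \<Rightarrow> 'a"
  where "apex v n = center v n - (1/2)^(n+1) *\<^sub>R v n"

text \<open>A concave function, positively homogeneous about the apex and positive on a cone around
  the direction \<open>v n\<close>.\<close>

definition spike :: "(nat \<Rightarrow> 'a::real_inner) \<Rightarrow> nat \<Rightarrow> 'a \<Rightarrow> real"
  where "spike v n x = 4 * inner (v n) (x - apex v n) - 2 * norm (x - apex v n)"

definition hard :: "(nat \<Rightarrow> 'a::real_inner) \<Rightarrow> nat \<Rightarrow> 'a \<Rightarrow> real"
  where "hard v n x = max (- 1) (base v n x - max 0 (spike v n x))"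

section \<open>Linearity of the shift, and the gradient of \<open>base\<close>\<close>

lemma chain_shift_diff: "chain_shift v n (x - y) = chain_shift v n x - chain_shift v n y"
  by (simp add: chain_shift_def inner_diff_right scaleR_left_diff_distrib sum_subtractf)

lemma chain_shift_scaleR: "chain_shift v n (r *\<^sub>R x) = r *\<^sub>R chain_shift v n x"
  by (simp add: chain_shift_def scaleR_sum_right)

lemma bounded_linear_shift [bounded_linear]: "bounded_linear (chain_shift v n)"
  unfolding chain_shift_def by (intro bounded_linear_intros)

lemma bounded_linear_coshift [bounded_linear]: "bounded_linear (chain_coshift v n)"
  unfolding chain_coshift_def by (intro bounded_linear_intros)

lemma inner_shift: "inner z (chain_shift v n y) = inner (chain_coshift v n z) y"
  by (simp add: chain_shift_def chain_coshift_def inner_sum_left inner_sum_right inner_commute mult.commute)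

text \<open>Chain rule: the derivative of the norm at the residual r is the inner product with r /
  |r|, and the adjoint moves the linear part I - N/2 of the residual onto that vector.\<close>

lemma base_has_derivative:
  assumes "base v n x \<noteq> 0"
  shows "(base v n has_derivative (\<lambda>y. inner (base_grad v n x) y)) (at x within S)"
proof -
  have nz: "residual v n x \<noteq> 0" using assms by (auto simp: base_def)
  have 1: "(residual v n has_derivative (\<lambda>y. y - (1/2) *\<^sub>R chain_shift v n y)) (at x within S)"
    unfolding residual_def
    by (auto intro!: derivative_eq_intros bounded_linear_imp_has_derivative bounded_linear_intros)
  have 2: "(norm has_derivative (\<lambda>h. inner h (sgn (residual v n x))))
             (at (residual v n x))"
    using nz by (rule has_derivative_norm)
  have "((\<lambda>x. norm (residual v n x)) has_derivative
      (\<lambda>y. inner (y - (1/2) *\<^sub>R chain_shift v n y) (sgn (residual v n x)))) (at x within S)"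
    using has_derivative_compose[OF 1 2] .
  moreover have "inner (y - (1/2) *\<^sub>R chain_shift v n y) (sgn (residual v n x))
     = inner (base_grad v n x) y" for y
  proof -
    have "inner (y - (1/2) *\<^sub>R chain_shift v n y) (residual v n x)
      = inner (residual v n x - (1/2) *\<^sub>R chain_coshift v n (residual v n x)) y"
      by (simp add: inner_diff_left inner_diff_right inner_shift
          inner_commute[of _ "residual v n x"])
    then show ?thesis
      by (simp add: base_grad_def sgn_div_norm base_def inverse_eq_divide)
  qed
  ultimately show ?thesis by (simp add: base_def[abs_def])
qed

lemma isCont_residual: "isCont (residual v n) x"
  unfolding residual_def by (intro continuous_intros bounded_linear.isCont[OF bounded_linear_shift])

lemma isCont_base: "isCont (base v n) x"
  unfolding base_def by (intro continuous_intros isCont_residual)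

lemma isCont_base_grad:
  assumes "base v n x \<noteq> 0"
  shows "isCont (base_grad v n) x"
  unfolding base_grad_def using assms
  by (intro continuous_intros isCont_residual isCont_base
      isCont_o2[OF isCont_residual bounded_linear.isCont[OF bounded_linear_coshift]]) auto

text \<open>Bessel's inequality. The shift maps orthonormal vectors to orthonormal vectors, so its
  value at \<open>x\<close> is as long as the projection \<open>p\<close> of \<open>x\<close> to the
  span of \<open>v 0\<close>, ..., \<open>v (n-1)\<close>.\<close>

lemma norm_shift_le:
  assumes orth: "\<And>i j. i \<le> n \<Longrightarrow> j \<le> n \<Longrightarrow> inner (v i) (v j) = (if i = j then 1 else 0)"
  shows "norm (chain_shift v n x) \<le> norm x"
proof -
  define a where "a i = inner (v i) x" for i
  define p where "p = (\<Sum>i<n. a i *\<^sub>R v i)"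
  have fin: "(\<Sum>j<n. a i * (a j * (if i = j then 1 else 0))) = a i * a i" if "i < n" for i
  proof -
    have "(\<Sum>j<n. a i * (a j * (if i = j then 1 else 0))) = (\<Sum>j<n. if i = j then a i * a j else 0)"
      by (rule sum.cong) auto
    then show ?thesis using that by simp
  qed
  have 1: "inner (chain_shift v n x) (chain_shift v n x) = (\<Sum>i<n. a i * a i)"
  proof -
    have "inner (chain_shift v n x) (chain_shift v n x) =
      (\<Sum>i<n. \<Sum>j<n. a i * (a j * inner (v (Suc i)) (v (Suc j))))"
      unfolding chain_shift_def a_def inner_sum_left inner_sum_right
      by (subst sum.swap) (simp add: algebra_simps inner_commute)
    also have "\<dots> = (\<Sum>i<n. \<Sum>j<n. a i * (a j * (if i = j then 1 else 0)))"
      by (intro sum.cong refl) (simp add: orth)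
    also have "\<dots> = (\<Sum>i<n. a i * a i)" by (rule sum.cong) (auto simp only: fin lessThan_iff)
    finally show ?thesis .
  qed
  have 2: "inner p p = (\<Sum>i<n. a i * a i)"
  proof -
    have "inner p p = (\<Sum>i<n. \<Sum>j<n. a i * (a j * inner (v i) (v j)))"
      unfolding p_def inner_sum_left inner_sum_right
      by (subst sum.swap) (simp add: algebra_simps inner_commute)
    also have "\<dots> = (\<Sum>i<n. \<Sum>j<n. a i * (a j * (if i = j then 1 else 0)))"
      by (intro sum.cong refl) (simp add: orth)
    also have "\<dots> = (\<Sum>i<n. a i * a i)" by (rule sum.cong) (auto simp only: fin lessThan_iff)
    finally show ?thesis .
  qed
  have 3: "inner p x = (\<Sum>i<n. a i * a i)"
    by (simp add: p_def inner_sum_left a_def)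
  have "0 \<le> inner (x - p) (x - p)" by simp
  also have "\<dots> = inner x x - inner p p"
    using 2 3 by (simp add: inner_diff_left inner_diff_right inner_commute)
  finally have "inner (chain_shift v n x) (chain_shift v n x) \<le> inner x x" using 1 2 by simp
  then show ?thesis by (simp add: norm_eq_sqrt_inner)
qed

section \<open>Estimates for \<open>base\<close> and \<open>spike\<close> over an orthonormal
  chain\<close>

locale orthonormal_chain =
  fixes v :: "nat \<Rightarrow> 'a::real_inner" and n :: nat
  assumes orth: "i \<le> n \<Longrightarrow> j \<le> n \<Longrightarrow> inner (v i) (v j) = (if i = j then 1 else 0)"
begin

lemma inner_center:
  assumes "k \<le> n"
  shows "inner (v k) (center v n) = (1/2)^k"
proof -
  have "inner (v k) (center v n) = (\<Sum>i\<le>n. if k = i then (1/2)^i else 0)"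
    unfolding center_def inner_sum_right by (rule sum.cong) (auto simp: orth assms)
  then show ?thesis using assms by simp
qed

text \<open>Shifting the geometric series and halving it gives the same series without its first
  term \<open>v 0\<close>.\<close>

lemma residual_center: "residual v n (center v n) = 0"
proof -
  have "chain_shift v n (center v n) = (\<Sum>i<n. (1/2)^i *\<^sub>R v (Suc i))"
    unfolding chain_shift_def by (rule sum.cong) (simp_all add: inner_center)
  moreover have "center v n = v 0 + (\<Sum>i<n. (1/2)^(Suc i) *\<^sub>R v (Suc i))"
    unfolding center_def by (simp add: sum.atMost_shift)
  ultimately show ?thesis by (simp add: residual_def scaleR_sum_right)
qed

lemma residual_diff:
  "residual v n x - residual v n y = (x - y) - (1/2) *\<^sub>R chain_shift v n (x - y)"
  by (simp add: residual_def chain_shift_diff algebra_simps)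

lemma norm_v: "i \<le> n \<Longrightarrow> norm (v i) = 1"
  using orth[of i i] by (simp add: norm_eq_sqrt_inner)

lemma norm_shift: "norm (chain_shift v n x) \<le> norm x"
  by (rule norm_shift_le) (rule orth)

text \<open>The residual is (I - N/2) applied to \<open>x - center v n\<close>, and N/2 has norm at
  most 1/2.\<close>

lemma base_ge: "norm (x - center v n) / 2 \<le> base v n x"
proof -
  let ?y = "x - center v n"
  have "residual v n x = ?y - (1/2) *\<^sub>R chain_shift v n ?y"
    using residual_diff[of x "center v n"] by (simp add: residual_center)
  moreover have "norm (?y - (1/2) *\<^sub>R chain_shift v n ?y) \<ge> norm ?y - norm ((1/2) *\<^sub>R chain_shift v n ?y)"
    by (rule norm_triangle_ineq2)
  ultimately show ?thesis using norm_shift[of ?y] by (simp add: base_def)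
qed

lemma base_lipschitz: "\<bar>base v n x - base v n y\<bar> \<le> 3/2 * norm (x - y)"
proof -
  have "\<bar>base v n x - base v n y\<bar> \<le> norm (residual v n x - residual v n y)"
    unfolding base_def by (rule norm_triangle_ineq3)
  also have "\<dots> \<le> norm (x - y) + norm ((1/2) *\<^sub>R chain_shift v n (x - y))"
    unfolding residual_diff by (rule norm_triangle_ineq4)
  also have "\<dots> \<le> 3/2 * norm (x - y)" using norm_shift[of "x - y"] by simp
  finally show ?thesis .
qed

text \<open>The residual is affine and vanishes at the center, so on the segment towards it the
  residual is multiplied by 1 - t.\<close>

lemma base_toward_center:
  assumes "t \<le> 1"
  shows "base v n (x + t *\<^sub>R (center v n - x)) = (1 - t) * base v n x"
proof -
  let ?w = "center v n - x"
  have "residual v n (x + t *\<^sub>R ?w) - residual v n x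
      = t *\<^sub>R ?w - (1/2) *\<^sub>R chain_shift v n (t *\<^sub>R ?w)"
    by (simp add: residual_diff)
  also have "\<dots> = t *\<^sub>R (?w - (1/2) *\<^sub>R chain_shift v n ?w)"
    unfolding chain_shift_scaleR by (simp add: scaleR_right_diff_distrib)
  also have "\<dots> = t *\<^sub>R (residual v n (center v n) - residual v n x)"
    by (simp add: residual_diff)
  finally have "residual v n (x + t *\<^sub>R ?w) - residual v n x = \<dots>" .
  then have "residual v n (x + t *\<^sub>R (center v n - x)) = (1 - t) *\<^sub>R residual v n x"
    by (simp add: residual_center algebra_simps)
  then show ?thesis using assms by (simp add: base_def)
qed

lemma base_0: "base v n 0 = 1"
  using norm_v[of 0] by (simp add: base_def residual_def chain_shift_def)

lemma spike_lipschitz: "\<bar>spike v n x - spike v n y\<bar> \<le> 6 * norm (x - y)"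
proof -
  have "spike v n x - spike v n y =
    4 * inner (v n) (x - y) - 2 * (norm (x - apex v n) - norm (y - apex v n))"
    by (simp add: spike_def inner_diff_right)
  moreover have "\<bar>inner (v n) (x - y)\<bar> \<le> norm (x - y)"
    using Cauchy_Schwarz_ineq2[of "v n" "x - y"] norm_v[of n] by simp
  moreover have "\<bar>norm (x - apex v n) - norm (y - apex v n)\<bar> \<le> norm (x - y)"
    using norm_triangle_ineq3[of "x - apex v n" "y - apex v n"] by simp
  moreover have "\<bar>4 * p - 2 * q\<bar> \<le> 6 * m" if "\<bar>p\<bar> \<le> m" "\<bar>q\<bar> \<le> m" for p q m :: real
    using that by linarith
  ultimately show ?thesis by simp
qed

text \<open>The linear term gains 4t and the cone term loses at most 2t. The net slope 2 exceeds the
  Lipschitz constant 3/2 of \<open>base\<close>.\<close>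

lemma spike_along_axis:
  assumes "0 \<le> t"
  shows "spike v n x + 2 * t \<le> spike v n (x + t *\<^sub>R v n)"
proof -
  have "norm (x + t *\<^sub>R v n - apex v n) \<le> norm (x - apex v n) + t"
    using norm_triangle_ineq[of "x - apex v n" "t *\<^sub>R v n"] assms norm_v[of n]
    by (simp add: algebra_simps)
  then show ?thesis using orth[of n n]
    by (simp add: spike_def inner_diff_right inner_add_right algebra_simps)
qed

text \<open>Concavity on the segment from \<open>x\<close> to the center, where the spike has the
  value 4b - 2b = (1/2)^n with b = (1/2)^(n+1).\<close>

lemma spike_toward_center:
  assumes "0 \<le> t" "t \<le> 1"
  shows "(1 - t) * spike v n x + t * (1/2)^n \<le> spike v n (x + t *\<^sub>R (center v n - x))"
proof -
  let ?z = "x - apex v n" and ?b = "(1/2)^(n+1) :: real"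
  have eq: "x + t *\<^sub>R (center v n - x) - apex v n = (1 - t) *\<^sub>R ?z + (t * ?b) *\<^sub>R v n"
  proof -
    have "x + t *\<^sub>R (center v n - x) - apex v n
      = (1 - t) *\<^sub>R (x - center v n) + ?b *\<^sub>R v n"
      by (simp add: apex_def algebra_simps)
    also have "\<dots> = (1 - t) *\<^sub>R (x - center v n) + (1 - t) *\<^sub>R (?b *\<^sub>R v n) + (t * ?b) *\<^sub>R v n"
    proof -
      have "(1 - t) *\<^sub>R (?b *\<^sub>R v n) + (t * ?b) *\<^sub>R v n = ((1 - t) * ?b + t * ?b) *\<^sub>R v n"
        by (simp only: scaleR_scaleR scaleR_left_distrib)
      then show ?thesis by (simp only: left_diff_distrib) (simp add: add.assoc)
    qed
    also have "\<dots> = (1 - t) *\<^sub>R ?z + (t * ?b) *\<^sub>R v n"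
      by (simp add: apex_def scaleR_right_distrib scaleR_right_diff_distrib)
    finally show ?thesis .
  qed
  have "norm ((1 - t) *\<^sub>R ?z + (t * ?b) *\<^sub>R v n) \<le> (1 - t) * norm ?z + t * ?b"
    using norm_triangle_ineq[of "(1 - t) *\<^sub>R ?z" "(t * ?b) *\<^sub>R v n"] assms norm_v[of n]
    by simp
  then show ?thesis using orth[of n n]
    by (simp only: spike_def eq) (simp add: inner_add_right algebra_simps)
qed

lemma isCont_spike: "isCont (spike v n) x"
  unfolding spike_def by (intro continuous_intros)

lemma hard_lipschitz: "\<bar>hard v n x - hard v n y\<bar> \<le> 8 * norm (x - y)"
  using base_lipschitz[of x y] spike_lipschitz[of x y] norm_ge_zero[of "x - y"]
  unfolding hard_def by linarith

lemma hard_ge: "- 1 \<le> hard v n x"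
  by (simp add: hard_def)

lemma hard_0_le: "hard v n 0 \<le> 1"
  by (simp add: hard_def base_0)

text \<open>The apex has the positive \<open>v n\<close> component (1/2)^(n+1), so already the
  linear term is negative at \<open>x\<close>.\<close>

lemma spike_neg:
  assumes "inner (v n) x = 0"
  shows "spike v n x < 0"
proof -
  have "inner (v n) (x - apex v n) = - ((1/2)^(n+1))"
    using assms orth[of n n] inner_center[of n] by (simp add: apex_def inner_diff_right)
  then show ?thesis using norm_ge_zero[of "x - apex v n"] unfolding spike_def
    by (smt (verit) zero_less_power half_gt_zero_iff zero_less_one)
qed

lemma base_pos:
  assumes "inner (v n) x = 0"
  shows "0 < base v n x"
proof -
  have "x \<noteq> center v n" using assms inner_center[of n] by auto
  then show ?thesis using base_ge[of x]
    by (smt (verit) zero_less_norm_iff right_minus_eq half_gt_zero_iff)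
qed

end

section \<open>Clarke gradients\<close>

lemma Rn_subspace: "subspace (Rn d)"
  by (auto simp: subspace_def Rn_def zero_rvec.rep_eq plus_rvec.rep_eq scaleR_rvec.rep_eq)

lemma eventually_nhds_greater:
  fixes f :: "'a::t2_space \<Rightarrow> real"
  assumes "isCont f x" "a < f x"
  shows "\<forall>\<^sub>F y in nhds x. a < f y"
  using assms unfolding continuous_at tendsto_at_iff_tendsto_nhds by (simp add: order_tendstoD)

lemma eventually_nhds_less:
  fixes f :: "'a::t2_space \<Rightarrow> real"
  assumes "isCont f x" "f x < a"
  shows "\<forall>\<^sub>F y in nhds x. f y < a"
  using assms unfolding continuous_at tendsto_at_iff_tendsto_nhds by (simp add: order_tendstoD)

text \<open>Although the derivative is taken only within \<open>Rn d\<close>, the whole line through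
  \<open>y\<close> stays there, which gives an ordinary two-sided derivative in t.\<close>

lemma gradient_direction:
  assumes "has_gradient d f y G" "y \<in> Rn d" "V \<in> Rn d"
  shows "((\<lambda>t. f (y + t *\<^sub>R V)) has_real_derivative inner G V) (at 0)"
proof -
  have 1: "((\<lambda>t. y + t *\<^sub>R V) has_derivative (\<lambda>t. t *\<^sub>R V)) (at 0)"
    by (auto intro!: derivative_eq_intros)
  have "range (\<lambda>t. y + t *\<^sub>R V) \<subseteq> Rn d"
    using assms by (auto intro!: subspace_add subspace_scale Rn_subspace)
  then have 2: "(f has_derivative inner G) (at (y + 0 *\<^sub>R V) within range (\<lambda>t. y + t *\<^sub>R V))"
    using assms by (auto simp: has_gradient_def intro: has_derivative_subset)
  show ?thesis
    using has_derivative_in_compose[OF 1 2]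
    by (rule has_derivative_imp_has_field_derivative) simp
qed

text \<open>Both gradients lie in \<open>Rn d\<close>, so their difference is an admissible
  direction to test them on.\<close>

lemma gradient_unique:
  assumes "has_gradient d f y G" "has_gradient d f y G'" "y \<in> Rn d"
  shows "G = G'"
proof -
  have "G - G' \<in> Rn d"
    using assms by (auto simp: has_gradient_def intro: subspace_diff Rn_subspace)
  then have "inner G (G - G') = inner G' (G - G')"
    using gradient_direction assms DERIV_unique by metis
  then have "inner (G - G') (G - G') = 0" by (simp add: inner_diff_left)
  then show ?thesis by simp
qed

lemma gradient_descent_bound:
  assumes G: "has_gradient d f y G" "y \<in> Rn d" "V \<in> Rn d"
    and desc: "\<forall>\<^sub>F t in at_right 0. f (y + t *\<^sub>R V) \<le> f y - t * k"
  shows "inner G V \<le> - k"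
proof -
  have "((\<lambda>t. (f (y + t *\<^sub>R V) - f y) / t) \<longlongrightarrow> inner G V) (at 0)"
    using gradient_direction[OF G] by (simp add: has_field_derivative_iff)
  then have "((\<lambda>t. (f (y + t *\<^sub>R V) - f y) / t) \<longlongrightarrow> inner G V) (at_right 0)"
    by (rule tendsto_mono[rotated]) (simp add: at_le)
  moreover have "\<forall>\<^sub>F t in at_right 0. (f (y + t *\<^sub>R V) - f y) / t \<le> - k"
    using desc eventually_at_right_less[of 0]
    by eventually_elim (simp add: divide_le_eq algebra_simps)
  ultimately show ?thesis by (rule tendsto_upperbound) simp
qed

text \<open>A uniform descent rate near \<open>x\<close> passes from gradients at nearby points to
  their limits by continuity of \<open>V\<close> and \<open>k\<close>, and from the limits to their
  convex hull because a halfspace is convex.\<close>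

lemma clarke_descent_bound:
  assumes u: "u \<in> clarke d f x"
    and V: "isCont V x" "\<And>y. y \<in> Rn d \<Longrightarrow> V y \<in> Rn d" and k: "isCont k x"
    and desc: "\<forall>\<^sub>F y in nhds x. y \<in> Rn d \<longrightarrow>
      (\<forall>\<^sub>F t in at_right 0. f (y + t *\<^sub>R V y) \<le> f y - t * k y)"
  shows "inner u (V x) \<le> - k x"
proof -
  have "clarke d f x \<subseteq> {u. inner (V x) u \<le> - k x}"
    unfolding clarke_def
  proof (rule hull_minimal, safe)
    fix u X G
    assume XG: "\<forall>m::nat. X m \<in> Rn d \<and> has_gradient d f (X m) (G m)"
      and X: "X \<longlonglongrightarrow> x" and G: "G \<longlonglongrightarrow> u"
    have "\<forall>\<^sub>F m in sequentially. inner (V (X m)) (G m) \<le> - k (X m)"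
      using eventually_compose_filterlim[OF desc X]
    proof eventually_elim
      case (elim m)
      with XG have "inner (G m) (V (X m)) \<le> - k (X m)"
        by (intro gradient_descent_bound[of d f "X m"] V) auto
      then show ?case by (simp add: inner_commute)
    qed
    moreover have "(\<lambda>m. inner (V (X m)) (G m)) \<longlonglongrightarrow> inner (V x) u"
      by (intro tendsto_inner isCont_tendsto_compose[OF V(1)] X G)
    moreover have "(\<lambda>m. - k (X m)) \<longlonglongrightarrow> - k x"
      by (intro tendsto_minus isCont_tendsto_compose[OF k] X)
    ultimately show "inner (V x) u \<le> - k x"
      by (rule_tac tendsto_le[OF sequentially_bot])
  qed (rule convex_halfspace_le)
  with u show ?thesis by (auto simp: inner_commute)
qed

text \<open>Near \<open>x\<close> every gradient is given by the continuous \<open>g\<close>, so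
  \<open>g x\<close> is the only possible limit, and the hull of a singleton adds nothing.\<close>

lemma clarke_differentiable:
  assumes u: "u \<in> clarke d f x"
    and g: "\<forall>\<^sub>F y in nhds x. y \<in> Rn d \<longrightarrow> has_gradient d f y (g y)" "isCont g x"
  shows "u = g x"
proof -
  have "clarke d f x \<subseteq> {g x}"
    unfolding clarke_def
  proof (rule hull_minimal, safe)
    fix u X G
    assume XG: "\<forall>m::nat. X m \<in> Rn d \<and> has_gradient d f (X m) (G m)"
      and X: "X \<longlonglongrightarrow> x" and G: "G \<longlonglongrightarrow> u"
    have "\<forall>\<^sub>F m in sequentially. g (X m) = G m"
      using eventually_compose_filterlim[OF g(1) X]
      by eventually_elim (use XG gradient_unique in blast)
    moreover have "(\<lambda>m. g (X m)) \<longlonglongrightarrow> g x"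
      by (rule isCont_tendsto_compose[OF g(2) X])
    ultimately have "G \<longlonglongrightarrow> g x" by (rule Lim_transform_eventually[rotated])
    with G show "u = g x" by (rule LIMSEQ_unique)
  qed simp
  with u show ?thesis by auto
qed

lemma base_grad_Rn:
  assumes "\<And>i. i \<le> n \<Longrightarrow> v i \<in> Rn d" "x \<in> Rn d"
  shows "base_grad v n x \<in> Rn d"
  unfolding base_grad_def residual_def chain_shift_def chain_coshift_def
  by (intro subspace_sum subspace_scale subspace_diff Rn_subspace assms) auto

section \<open>Clarke gradients and stationary points of the hard function in
  \<open>Rn d\<close>\<close>

locale Rn_chain = orthonormal_chain v n for v :: "nat \<Rightarrow> rvec" and n :: nat +
  fixes d :: nat
  assumes v_Rn: "\<And>i. i \<le> n \<Longrightarrow> v i \<in> Rn d"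
begin

lemma center_Rn: "center v n \<in> Rn d"
  unfolding center_def by (intro subspace_sum subspace_scale Rn_subspace v_Rn) simp

lemma hard_lipschitz_on: "8-lipschitz_on (Rn d) (hard v n)"
  by (rule lipschitz_onI) (simp_all add: dist_norm hard_lipschitz)

lemma hard_bdd_below: "bdd_below (hard v n ` Rn d)"
  by (rule bdd_belowI2) (rule hard_ge)

text \<open>Membership in this class is what makes the answers of an oracle from
  \<open>oracles d\<close> Clarke gradients.\<close>

lemma hard_in_class: "hard v n \<in> lipschitz_bdd_below d"
  using hard_lipschitz_on hard_bdd_below by (auto simp: lipschitz_bdd_below_def)

lemma hard_gap: "hard v n 0 - (INF x\<in>Rn d. hard v n x) \<le> 8"
proof -
  have "- 1 \<le> (INF x\<in>Rn d. hard v n x)"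
    using subspace_0[OF Rn_subspace] by (intro cINF_greatest hard_ge) auto
  then show ?thesis using hard_0_le by linarith
qed

text \<open>On the hyperplane the spike is strictly negative and \<open>base\<close> strictly
  positive. Both persist nearby, so neither maximum in \<open>hard\<close> is felt.\<close>

lemma eventually_hard_eq_base:
  assumes "inner (v n) x = 0"
  shows "\<forall>\<^sub>F y in nhds x. hard v n y = base v n y \<and> base v n y \<noteq> 0"
proof -
  have 1: "\<forall>\<^sub>F y in nhds x. spike v n y < 0"
    using isCont_spike spike_neg[OF assms] by (rule eventually_nhds_less)
  have 2: "\<forall>\<^sub>F y in nhds x. 0 < base v n y"
    using isCont_base base_pos[OF assms] by (rule eventually_nhds_greater)
  from 1 2 show ?thesis by eventually_elim (auto simp: hard_def)
qed

lemma hard_eq_base: "inner (v n) x = 0 \<Longrightarrow> hard v n x = base v n x"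
  using eventually_nhds_x_imp_x[OF eventually_hard_eq_base] by blast

text \<open>At such a query the oracle has no choice: its answer is the gradient of
  \<open>base\<close>.\<close>

lemma clarke_hard:
  assumes "inner (v n) x = 0" "u \<in> clarke d (hard v n) x"
  shows "u = base_grad v n x"
proof (rule clarke_differentiable[OF assms(2)])
  \<comment> \<open>The quantifier is nested because transferring the derivative at \<open>y\<close>
    requires agreement on a neighbourhood of \<open>y\<close>.\<close>
  have "\<forall>\<^sub>F y in nhds x. \<forall>\<^sub>F z in nhds y. hard v n z = base v n z \<and> base v n z \<noteq> 0"
    using eventually_hard_eq_base[OF assms(1)] by (simp add: eventually_eventually)
  then show "\<forall>\<^sub>F y in nhds x. y \<in> Rn d \<longrightarrow> has_gradient d (hard v n) y (base_grad v n y)"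
  proof eventually_elim
    case (elim y)
    have y: "hard v n y = base v n y" "base v n y \<noteq> 0"
      using eventually_nhds_x_imp_x[OF elim] by auto
    have ev: "\<forall>\<^sub>F z in at y within Rn d. base v n z = hard v n z"
      using elim unfolding eventually_at_filter by eventually_elim simp
    show ?case
    proof
      assume "y \<in> Rn d"
      then show "has_gradient d (hard v n) y (base_grad v n y)"
        unfolding has_gradient_def
        using has_derivative_transform_eventually[OF base_has_derivative[OF y(2)] ev] y(1)
          base_grad_Rn[OF v_Rn] by auto
    qed
  qed
  show "isCont (base_grad v n) x"
    using base_pos[OF assms(1)] by (intro isCont_base_grad) simp
qed

text \<open>Wherever the truncation at -1 is inactive there is a direction of steep descent: along
  \<open>v n\<close> where the spike is positive, and towards the center elsewhere. Each forces
  \<open>norm u\<close> to be at least 1/2, above the threshold 1/8.\<close>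

lemma stationary_hard:
  assumes "x \<in> stationary_points d (1/8) (hard v n)"
  shows "hard v n x = - 1"
proof (rule ccontr)
  let ?f = "\<lambda>y. base v n y - max 0 (spike v n y)"
  assume "hard v n x \<noteq> - 1"
  then have fx: "- 1 < ?f x" by (auto simp: hard_def max_def split: if_splits)
  have cont: "isCont ?f x"
    by (intro continuous_intros isCont_base isCont_spike)
  have "\<forall>\<^sub>F y in nhds x. - 1 < ?f y"
    using cont fx by (rule eventually_nhds_greater)
  then have ev: "\<forall>\<^sub>F y in nhds x. \<forall>\<^sub>F z in nhds y. - 1 < ?f z"
    by (simp add: eventually_eventually)
  \<comment> \<open>Short moves from \<open>y\<close> keep the truncation inactive, so descent can
    be computed without it.\<close>
  have ray: "\<forall>\<^sub>F t in at_right 0. - 1 < ?f (y + t *\<^sub>R V)"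
    if "\<forall>\<^sub>F z in nhds y. - 1 < ?f z" for y V
  proof -
    have "((\<lambda>t. y + t *\<^sub>R V) \<longlongrightarrow> y + 0 *\<^sub>R V) (at_right 0)"
      by (intro tendsto_intros)
    then have "filterlim (\<lambda>t. y + t *\<^sub>R V) (nhds y) (at_right 0)" by simp
    then show ?thesis by (rule eventually_compose_filterlim[OF that])
  qed
  obtain u where u: "u \<in> clarke d (hard v n) x" "norm u \<le> 1/8" and x: "x \<in> Rn d"
    using assms by (auto simp: stationary_points_def)
  show False
  proof (cases "0 < spike v n x")
    case True
    with isCont_spike have pos: "\<forall>\<^sub>F y in nhds x. 0 < spike v n y"
      by (rule eventually_nhds_greater)
    \<comment> \<open>The rate 1/2 is the slope 2 of the spike minus the slope 3/2 of
      \<open>base\<close>.\<close>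
    have "inner u (v n) \<le> - (1/2)"
    proof (rule clarke_descent_bound[OF u(1), where V = "\<lambda>_. v n" and k = "\<lambda>_. 1/2"])
      show "\<forall>\<^sub>F y in nhds x. y \<in> Rn d \<longrightarrow>
        (\<forall>\<^sub>F t in at_right 0. hard v n (y + t *\<^sub>R v n) \<le> hard v n y - t * (1/2))"
        using ev pos
      proof eventually_elim
        case (elim y)
        have fy: "- 1 < ?f y" using eventually_nhds_x_imp_x[OF elim(1)] .
        show ?case
        proof
          show "\<forall>\<^sub>F t in at_right 0. hard v n (y + t *\<^sub>R v n) \<le> hard v n y - t * (1/2)"
            using ray[OF elim(1), of "v n"] eventually_at_right_less[of 0]
          proof eventually_elim
            case (elim t)
            have "base v n (y + t *\<^sub>R v n) \<le> base v n y + 3/2 * t"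
              using order_trans[OF abs_ge_self base_lipschitz[of "y + t *\<^sub>R v n" y]]
                elim norm_v[of n] by simp
            then show ?case
              using spike_along_axis[of t y] elim fy \<open>0 < spike v n y\<close>
              unfolding hard_def by simp
          qed
        qed
      qed
    qed (use v_Rn in auto)
    moreover have "\<bar>inner u (v n)\<bar> \<le> norm u"
      using Cauchy_Schwarz_ineq2[of u "v n"] norm_v[of n] by simp
    ultimately show False using u(2) by simp
  next
    case False
    \<comment> \<open>The bound \<open>spike v n x \<le> 0\<close> need not hold near
      \<open>x\<close>. This strict bound by the value at the center is an open condition and still
      prevents the spike from decreasing towards the center.\<close>
    have "spike v n x < (1/2)^n" 
    proof -
      have "0 < (1/2::real)^n" by simp
      with False show ?thesis by linarith
    qed
    with isCont_spike have small: "\<forall>\<^sub>F y in nhds x. spike v n y < (1/2)^n"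
      by (rule eventually_nhds_less)
    \<comment> \<open>Towards the center \<open>base\<close> falls at the rate
      \<open>base v n y\<close> while the spike does not fall.\<close>
    have "inner u (center v n - x) \<le> - base v n x"
    proof (rule clarke_descent_bound[OF u(1), where V = "\<lambda>y. center v n - y" and k = "base v n"])
      show "\<forall>\<^sub>F y in nhds x. y \<in> Rn d \<longrightarrow> (\<forall>\<^sub>F t in at_right 0.
        hard v n (y + t *\<^sub>R (center v n - y)) \<le> hard v n y - t * base v n y)"
        using ev small
      proof eventually_elim
        case (elim y)
        have fy: "- 1 < ?f y" using eventually_nhds_x_imp_x[OF elim(1)] .
        show ?case
        proof
          show "\<forall>\<^sub>F t in at_right 0.
              hard v n (y + t *\<^sub>R (center v n - y)) \<le> hard v n y - t * base v n y"
            using ray[OF elim(1), of "center v n - y"] eventually_at_right_less[of 0]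
              eventually_at_right_real[of 0 1, OF zero_less_one]
          proof eventually_elim
            case (elim t)
            have "0 \<le> t * ((1/2)^n - spike v n y)"
              using elim \<open>spike v n y < (1/2)^n\<close> by (intro mult_nonneg_nonneg) auto
            moreover have "(1 - t) * spike v n y + t * (1/2)^n
                \<le> spike v n (y + t *\<^sub>R (center v n - y))"
              using elim by (intro spike_toward_center) auto
            ultimately have "spike v n y \<le> spike v n (y + t *\<^sub>R (center v n - y))"
              unfolding left_diff_distrib right_diff_distrib by linarith
            moreover have "base v n (y + t *\<^sub>R (center v n - y)) = base v n y - t * base v n y"
              using base_toward_center[of t y] elim by (simp add: algebra_simps)
            ultimately show ?case using elim fy unfolding hard_def by simp
          qed
        qed
      qed
      show "center v n - y \<in> Rn d" if "y \<in> Rn d" for y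
        using that center_Rn Rn_subspace by (rule_tac subspace_diff)
    qed (auto intro: isCont_base)
    then have "norm (center v n - x) / 2 \<le> norm u * norm (center v n - x)"
      using base_ge[of x] Cauchy_Schwarz_ineq2[of u "center v n - x"]
      by (simp add: norm_minus_commute)
    \<comment> \<open>The spike is positive at the center, which excludes it in this case and allows
      division by the distance.\<close>
    moreover have "center v n \<noteq> x"
    proof
      assume "center v n = x"
      then have "(1/2)^n \<le> spike v n x" using spike_toward_center[of 1 x] by simp
      moreover have "0 < (1/2::real)^n" by simp
      ultimately show False using False by linarith
    qed
    ultimately have "1/2 \<le> norm u" by simp
    then show False using u(2) by simp
  qed
qed

text \<open>The values at \<open>y\<close> and \<open>x\<close> are positive and -1, hence more than
  1 apart, and \<open>hard\<close> is 8-Lipschitz. This is the origin of the constant 1/8.\<close>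

lemma stationary_far:
  assumes "inner (v n) y = 0" "x \<in> stationary_points d (1/8) (hard v n)"
  shows "1/8 \<le> norm (y - x)"
  using hard_lipschitz[of y x] hard_eq_base[OF assms(1)] stationary_hard[OF assms(2)]
    base_pos[OF assms(1)] by linarith

end

section \<open>Algorithms\<close>

text \<open>The infimum is taken in the extended reals so that it is infinite over an empty set of
  stationary points.\<close>

definition far_from_stationary :: "nat \<Rightarrow> real \<Rightarrow> (rvec \<Rightarrow> real) \<Rightarrow> (nat \<Rightarrow> rvec) \<Rightarrow> nat \<Rightarrow> bool"
  where "far_from_stationary d c h x T \<longleftrightarrow>
    (INF y\<in>stationary_points d c h. ereal (MIN t\<in>{1..T}. norm (x t - y))) \<ge> ereal c"

lemma (in Rn_chain) far_if_orthogonal: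
  assumes "T > 0" "\<And>t. t \<in> {1..T} \<Longrightarrow> inner (v n) (x t) = 0"
  shows "far_from_stationary d (1/8) (hard v n) x T"
  unfolding far_from_stationary_def
proof (rule INF_greatest)
  fix y assume "y \<in> stationary_points d (1/8) (hard v n)"
  then have "\<forall>t\<in>{1..T}. 1/8 \<le> norm (x t - y)"
    using stationary_far assms(2) by blast
  then have "1/8 \<le> (MIN t\<in>{1..T}. norm (x t - y))"
    using assms(1) by (intro Min.boundedI) auto
  then show "ereal (1/8) \<le> ereal (MIN t\<in>{1..T}. norm (x t - y))" by simp
qed

section \<open>How much of the chain a single query reveals\<close>

lemma residual_truncate:
  assumes "j \<le> n" "\<And>i. j \<le> i \<Longrightarrow> i \<le> n \<Longrightarrow> inner (v i) x = 0"
  shows "residual v n x = x - (1/2) *\<^sub>R chain_shift v j x - v 0"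
proof -
  have "chain_shift v n x = chain_shift v j x"
    unfolding chain_shift_def using assms by (intro sum.mono_neutral_right) auto
  then show ?thesis by (simp add: residual_def)
qed

text \<open>For i >= j, the residual is orthogonal to \<open>v (Suc i)\<close>: so are
  \<open>x\<close> and \<open>v 0\<close>, and the shift of \<open>x\<close> has no such component
  because \<open>x\<close> is orthogonal to \<open>v i\<close>. Only orthogonality is assumed, so
  zero vectors are allowed.\<close>

lemma coshift_truncate:
  assumes "j \<le> n" "\<And>i. j \<le> i \<Longrightarrow> i \<le> n \<Longrightarrow> inner (v i) x = 0"
    and orth: "\<And>i l. i \<le> n \<Longrightarrow> l \<le> n \<Longrightarrow> i \<noteq> l \<Longrightarrow> inner (v i) (v l) = 0"
  shows "chain_coshift v n (residual v n x) = chain_coshift v j (residual v n x)"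
proof -
  have "inner (v (Suc i)) (residual v n x) = 0" if i: "j \<le> i" "i < n" for i
  proof -
    have "inner (v l) x * inner (v (Suc i)) (v (Suc l)) = 0" if "l < n" for l
      using that i assms(2)[of i] orth[of "Suc i" "Suc l"] by (cases "l = i") auto
    then have "inner (v (Suc i)) (chain_shift v n x) = 0"
      unfolding chain_shift_def inner_sum_right by (intro sum.neutral) simp
    then show ?thesis
      using i assms(2)[of "Suc i"] orth[of "Suc i" 0] by (simp add: residual_def inner_diff_right)
  qed
  then show ?thesis
    unfolding chain_coshift_def using assms(1) by (intro sum.mono_neutral_right) auto
qed

text \<open>The truncated shift and coshift involve only \<open>v 0\<close>, ...,
  \<open>v j\<close>, so at most \<open>v j\<close> is new.\<close>

lemma base_grad_in_span:
  assumes hidden: "j \<le> n" "\<And>i. j \<le> i \<Longrightarrow> i \<le> n \<Longrightarrow> inner (v i) x = 0"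
    and orth: "\<And>i l. i \<le> n \<Longrightarrow> l \<le> n \<Longrightarrow> i \<noteq> l \<Longrightarrow> inner (v i) (v l) = 0"
    and x: "x \<in> span (v ` {..j})"
  shows "base_grad v n x \<in> span (v ` {..j})"
proof -
  have "residual v n x = x - (1/2) *\<^sub>R chain_shift v j x - v 0"
    by (rule residual_truncate) (use hidden in auto)
  then have r: "residual v n x \<in> span (v ` {..j})"
    unfolding chain_shift_def
    by (auto intro!: span_diff span_scale span_sum x intro: span_base)
  have "chain_coshift v n (residual v n x) = chain_coshift v j (residual v n x)"
    by (rule coshift_truncate) (use hidden orth in auto)
  then show ?thesis
    unfolding base_grad_def chain_coshift_def
    by (auto intro!: span_diff span_scale span_sum r intro: span_base)
qed

text \<open>The answers at \<open>x\<close> are determined by \<open>v 0\<close>, ...,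
  \<open>v j\<close>. The later vectors can therefore be chosen after the query, provided they are
  orthogonal to it.\<close>

lemma base_cong:
  assumes j: "j \<le> n" and agree: "\<And>i. i \<le> j \<Longrightarrow> v' i = v i"
    and hidden: "\<And>i. j \<le> i \<Longrightarrow> i \<le> n \<Longrightarrow> inner (v i) x = 0"
      "\<And>i. j \<le> i \<Longrightarrow> i \<le> n \<Longrightarrow> inner (v' i) x = 0"
    and orth: "\<And>i l. i \<le> n \<Longrightarrow> l \<le> n \<Longrightarrow> i \<noteq> l \<Longrightarrow> inner (v i) (v l) = 0"
      "\<And>i l. i \<le> n \<Longrightarrow> l \<le> n \<Longrightarrow> i \<noteq> l \<Longrightarrow> inner (v' i) (v' l) = 0"
  shows "base v' n x = base v n x" "base_grad v' n x = base_grad v n x"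
proof -
  have "chain_shift v' j x = chain_shift v j x"
    unfolding chain_shift_def by (rule sum.cong) (auto simp: agree)
  then have r: "residual v' n x = residual v n x"
    using residual_truncate[of j n v x, OF j hidden(1)]
      residual_truncate[of j n v' x, OF j hidden(2)] by (simp add: agree)
  then show b: "base v' n x = base v n x" by (simp add: base_def)
  have "chain_coshift v' j z = chain_coshift v j z" for z
    unfolding chain_coshift_def by (rule sum.cong) (auto simp: agree)
  then show "base_grad v' n x = base_grad v n x"
    using coshift_truncate[of j n v x, OF j hidden(1) orth(1)]
      coshift_truncate[of j n v' x, OF j hidden(2) orth(2)] r b
    by (simp add: base_grad_def)
qed

section \<open>Standard basis vectors, and unit vectors orthogonal to few given ones\<close>

definition unit_vec :: "nat \<Rightarrow> rvec"
  where "unit_vec i = Abs_rvec (\<lambda>j. if j = i then 1 else 0)"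

lemma coord_unit_vec: "coord (unit_vec i) j = (if j = i then 1 else 0)"
  unfolding unit_vec_def by (subst Abs_rvec_inverse) auto

lemma inner_unit_vec: "inner (unit_vec i) (unit_vec j) = (if i = j then 1 else 0)"
  by (simp add: inner_rvec_def coord_unit_vec)

lemma unit_vec_Rn: "i < d \<Longrightarrow> unit_vec i \<in> Rn d"
  by (simp add: Rn_def coord_unit_vec)

lemma inj_unit_vec: "inj unit_vec"
proof (rule injI)
  fix i j assume "unit_vec i = unit_vec j"
  then have "inner (unit_vec i) (unit_vec j) = 1" by (simp add: inner_unit_vec)
  then show "i = j" by (simp add: inner_unit_vec split: if_splits)
qed

lemma independent_unit_vec: "independent (unit_vec ` {..<d})"
proof (rule pairwise_orthogonal_independent)
  show "pairwise orthogonal (unit_vec ` {..<d})"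
    by (auto simp: pairwise_def orthogonal_def inner_unit_vec)
  have "unit_vec i \<noteq> 0" for i
    using inner_unit_vec[of i i] by auto
  then show "0 \<notin> unit_vec ` {..<d}" by force
qed

text \<open>Fewer than \<open>d\<close> vectors cannot span all \<open>d\<close> standard basis
  vectors. One outside the span, minus its projection \<open>p\<close>, is nonzero and can be
  normalized.\<close>

lemma exists_unit_orthogonal:
  assumes S: "finite S" "S \<subseteq> Rn d" "card S < d"
  obtains u where "u \<in> Rn d" "norm u = 1" "\<And>s. s \<in> S \<Longrightarrow> inner u s = 0"
proof -
  obtain B where B: "finite B" "card B \<le> card S" "span B = span S" "pairwise orthogonal B"
    using basis_orthogonal[OF S(1)] by blast
  have "\<not> unit_vec ` {..<d} \<subseteq> span B"
    using independent_span_bound[OF B(1) independent_unit_vec, of d] B(2) S(3)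
    by (auto simp: card_image inj_on_subset[OF inj_unit_vec])
  then obtain i where i: "i < d" "unit_vec i \<notin> span B" by blast
  \<comment> \<open>A possible zero vector in \<open>B\<close> is harmless, since its summand is
    zero.\<close>
  define p where "p = (\<Sum>b\<in>B. (inner b (unit_vec i) / inner b b) *\<^sub>R b)"
  define w where "w = unit_vec i - p"
  have p: "p \<in> span B" unfolding p_def by (intro span_sum span_scale span_base)
  have "span B \<subseteq> Rn d" using B(3) S(2) Rn_subspace by (simp add: span_minimal)
  with p i have w: "w \<in> Rn d" unfolding w_def
    by (auto intro: subspace_diff Rn_subspace unit_vec_Rn)
  have w0: "w \<noteq> 0" using p i by (auto simp: w_def)
  have wB: "orthogonal w c" if "c \<in> B" for c
  proof -
    have "inner c p = (\<Sum>b\<in>B. if b = c then inner c (unit_vec i) else 0)"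
      unfolding p_def inner_sum_right
    proof (rule sum.cong)
      fix b assume "b \<in> B"
      then show "inner c ((inner b (unit_vec i) / inner b b) *\<^sub>R b)
          = (if b = c then inner c (unit_vec i) else 0)"
        using B(4) that by (auto simp: pairwise_def orthogonal_def)
    qed simp
    then have "inner c w = 0" using that B(1) by (simp add: w_def inner_diff_right)
    then show ?thesis by (simp add: orthogonal_def inner_commute)
  qed
  have wS: "inner w s = 0" if "s \<in> S" for s
  proof -
    have "s \<in> span B" using B(3) that span_base by blast
    then have "orthogonal w s" using wB orthogonal_to_span by blast
    then show ?thesis by (simp add: orthogonal_def)
  qed
  show ?thesis
  proof
    show "(1 / norm w) *\<^sub>R w \<in> Rn d" using w Rn_subspace by (rule_tac subspace_scale)
  qed (use w0 wS in auto)
qed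

text \<open>Each answer reveals at most one new basis vector, so \<open>x (Suc j)\<close> lies in
  the span of the first j of them. Up to iterate n + 1 all are orthogonal to
  \<open>unit_vec n\<close>.\<close>

lemma span_algorithm_far:
  assumes \<O>: "\<O> \<in> oracles d" and alg: "(M, A) \<in> span_algorithms d \<O>" and d: "n < d"
    and \<omega>: "\<omega> \<in> space M"
  shows "far_from_stationary d (1/8) (hard unit_vec n)
    (iter_pt (A \<omega>) (hard unit_vec n) (\<O> (hard unit_vec n))) (Suc n)"
proof -
  interpret Rn_chain unit_vec n d
    by unfold_locales (use d in \<open>auto simp: inner_unit_vec unit_vec_Rn\<close>)
  let ?h = "hard unit_vec n"
  define x where "x = iter_pt (A \<omega>) ?h (\<O> ?h)"
  have x1: "x 1 = 0" and xt: "\<And>t. t > 1 \<Longrightarrow> x t \<in> span ((\<lambda>i. \<O> ?h (x i)) ` {1..t - 1})"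
    using alg \<omega> hard_in_class unfolding span_algorithms_def x_def by (auto simp: Let_def)
  have in_span: "x (Suc j) \<in> span (unit_vec ` {..<j})" if "j \<le> n" for j
    using that
  proof (induction j rule: less_induct)
    case (less j)
    show ?case
    proof (cases "j = 0")
      case True
      then show ?thesis using x1 by (simp add: span_zero)
    next
      case False
      have "\<O> ?h (x i) \<in> span (unit_vec ` {..<j})" if i: "i \<in> {1..j}" for i
      proof -
        obtain l where l: "i = Suc l" "l < j" using i by (cases i) auto
        have xl: "x i \<in> span (unit_vec ` {..<l})" using less l by simp
        have hid: "inner (unit_vec m) (x i) = 0" if "l \<le> m" for m
        proof -
          have "orthogonal (unit_vec m) (x i)"
            by (rule orthogonal_to_span[OF xl]) (use that in \<open>auto simp: orthogonal_def inner_unit_vec\<close>)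
          then show ?thesis by (simp add: orthogonal_def)
        qed
        have "x i \<in> span (unit_vec ` {..l})" 
          using xl by (rule subsetD[OF span_mono, rotated]) auto
        then have g: "base_grad unit_vec n (x i) \<in> span (unit_vec ` {..l})"
          using l less.prems by (intro base_grad_in_span hid) (auto simp: inner_unit_vec)
        \<comment> \<open>The oracle is only trusted on queries in \<open>Rn d\<close>.\<close>
        have "span (unit_vec ` {..<l}) \<subseteq> Rn d"
          using l less.prems d by (intro span_minimal Rn_subspace) (auto intro: unit_vec_Rn)
        then have "\<O> ?h (x i) \<in> clarke d ?h (x i)"
          using \<O> hard_in_class xl unfolding oracles_def by blast
        then have "\<O> ?h (x i) = base_grad unit_vec n (x i)"
          using l less.prems by (intro clarke_hard hid) auto
        moreover have "span (unit_vec ` {..l}) \<subseteq> span (unit_vec ` {..<j})"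
          using l by (intro span_mono) auto
        ultimately show ?thesis using g by auto
      qed
      then have "span ((\<lambda>i. \<O> ?h (x i)) ` {1..j}) \<subseteq> span (unit_vec ` {..<j})"
        by (intro span_minimal subspace_span) auto
      then show ?thesis using xt[of "Suc j"] False by auto
    qed
  qed
  have "inner (unit_vec n) (x t) = 0" if t: "t \<in> {1..Suc n}" for t
  proof -
    obtain j where j: "t = Suc j" "j \<le> n" using t by (cases t) auto
    have "orthogonal (unit_vec n) (x t)"
      by (rule orthogonal_to_span[of _ "unit_vec ` {..<j}"])
         (use j in_span in \<open>auto simp: orthogonal_def inner_unit_vec\<close>)
    then show ?thesis by (simp add: orthogonal_def)
  qed
  then show ?thesis unfolding x_def by (intro far_if_orthogonal) auto
qed

section \<open>Deterministic algorithms and the resisting oracle\<close>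

lemma answers_in_histories:
  assumes a: "\<And>H. H \<in> histories d \<Longrightarrow> a H \<in> Rn d" and g: "\<And>x. x \<in> Rn d \<Longrightarrow> g x \<in> Rn d"
  shows "answers a f g t \<in> histories d"
proof (induction t)
  case (Suc t)
  then show ?case using a g by (auto simp: histories_def Let_def)
qed (simp add: histories_def)

text \<open>The chain is built vector by vector, with zeros in the places still open. The run is
  simulated with \<open>base\<close>, whose answers along it do not change when later vectors are
  filled in.\<close>

lemma resisting_chain:
  fixes a :: "history \<Rightarrow> rvec"
  defines "run \<equiv> \<lambda>v n t. a (answers a (base v n) (base_grad v n) t)"
  assumes a: "\<And>H. H \<in> histories d \<Longrightarrow> a H \<in> Rn d" and d: "2 * n + 1 < d" and k: "k \<le> Suc n"
  shows "\<exists>v. (\<forall>i. v i \<in> Rn d) \<and> (\<forall>i\<ge>k. v i = 0) \<and> (\<forall>i<k. norm (v i) = 1) \<and>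
    (\<forall>i j. i \<noteq> j \<longrightarrow> inner (v i) (v j) = 0) \<and> (\<forall>i<k. \<forall>j\<le>i. inner (v i) (run v n j) = 0)"
  using k
proof (induction k)
  case 0
  show ?case by (rule exI[of _ "\<lambda>_. 0"]) (simp add: subspace_0 Rn_subspace)
next
  case (Suc k)
  have "k \<le> Suc n" using Suc.prems by simp
  from Suc.IH[OF this] obtain v where v: "\<forall>i. v i \<in> Rn d" "\<forall>i\<ge>k. v i = 0"
    "\<forall>i<k. norm (v i) = 1" "\<forall>i j. i \<noteq> j \<longrightarrow> inner (v i) (v j) = 0"
    "\<forall>i<k. \<forall>j\<le>i. inner (v i) (run v n j) = 0"
    by (elim exE conjE) (rule that)
  note v_Rn = v(1)[rule_format] and v0 = v(2)[rule_format] and v1 = v(3)[rule_format]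
    and vo = v(4)[rule_format] and vr = v(5)[rule_format]
  have run_Rn: "run v n t \<in> Rn d" for t
    unfolding run_def by (intro a answers_in_histories base_grad_Rn v_Rn)
  \<comment> \<open>The new vector must avoid k old vectors and k + 1 queries. As k <= n, these are
    at most 2n + 1 < d vectors; this is where the dimension 2T is used.\<close>
  let ?S = "v ` {..<k} \<union> run v n ` {..k}"
  have "card ?S \<le> card (v ` {..<k}) + card (run v n ` {..k})" by (rule card_Un_le)
  also have "\<dots> \<le> k + Suc k"
    using card_image_le[of "{..<k}" v] card_image_le[of "{..k}" "run v n"] by simp
  finally have "card ?S < d" using d Suc.prems by simp
  then obtain u where u: "u \<in> Rn d" "norm u = 1" "\<And>s. s \<in> ?S \<Longrightarrow> inner u s = 0"
    using exists_unit_orthogonal[of ?S d] v_Rn run_Rn by auto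
  define v' where "v' = v(k := u)"
  have v'o: "inner (v' i) (v' j) = 0" if "i \<noteq> j" for i j
  proof -
    have "inner u (v j) = 0" for j using u(3)[of "v j"] v0[of j] by (cases "j < k") auto
    then show ?thesis using vo that by (simp add: v'_def inner_commute[of _ u])
  qed
  have hid: "inner (v i) (run v n j) = 0" if "j \<le> i" for i j
    using that vr[of i j] v0[of i] by (cases "i < k") auto
  have hid': "inner (v' i) (run v n j) = 0" if "j \<le> i" "j \<le> k" for i j
    using that hid[of j i] u(3)[of "run v n j"] by (auto simp: v'_def)
  \<comment> \<open>Replacing the zero at \<open>k\<close> by \<open>u\<close> leaves the first k
    answers unchanged: query j < k depends only on vectors up to j, and \<open>u\<close> is
    orthogonal to it.\<close>
  have ans: "answers a (base v' n) (base_grad v' n) j = answers a (base v n) (base_grad v n) j"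
    if "j \<le> k" for j
    using that
  proof (induction j)
    case (Suc j)
    have "base v' n (run v n j) = base v n (run v n j)"
      "base_grad v' n (run v n j) = base_grad v n (run v n j)"
      by (rule base_cong[of j]; use Suc.prems \<open>Suc k \<le> Suc n\<close> hid hid' vo v'o in \<open>simp add: v'_def\<close>)+
    then show ?case using Suc by (simp add: Let_def run_def)
  qed simp
  have run: "run v' n j = run v n j" if "j \<le> k" for j
    unfolding run_def by (simp add: ans that)
  show ?case
  proof (rule exI[of _ v'], intro conjI allI impI)
    show "v' i \<in> Rn d" for i using u(1) v_Rn by (simp add: v'_def)
    show "v' i = 0" if "Suc k \<le> i" for i using that v0 by (simp add: v'_def)
    show "norm (v' i) = 1" if "i < Suc k" for i using that v1 u(2) by (auto simp: v'_def less_Suc_eq)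
    show "inner (v' i) (v' j) = 0" if "i \<noteq> j" for i j using that by (rule v'o)
    show "inner (v' i) (run v' n j) = 0" if "i < Suc k" "j \<le> i" for i j
      using that hid'[of j i] by (simp add: run)
  qed
qed

text \<open>On the complete chain every simulated query is orthogonal to \<open>v n\<close>. There
  \<open>hard\<close> and the oracle give the answers of \<open>base\<close>, so the real run
  coincides with the simulation for every seed.\<close>

lemma det_algorithm_far:
  assumes \<O>: "\<O> \<in> oracles d" and alg: "(M, A) \<in> det_algorithms d" and d: "2 * n + 1 < d"
  obtains v where "Rn_chain v n d"
    "\<And>\<omega>. \<omega> \<in> space M \<Longrightarrow> far_from_stationary d (1/8) (hard v n)
      (iter_pt (A \<omega>) (hard v n) (\<O> (hard v n))) (Suc n)"
proof -
  obtain a where a: "\<And>\<omega> H. \<omega> \<in> space M \<Longrightarrow> H \<in> histories d \<Longrightarrow> A \<omega> H = a H"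
    and A: "\<And>\<omega> H. \<omega> \<in> space M \<Longrightarrow> H \<in> histories d \<Longrightarrow> A \<omega> H \<in> Rn d"
    and M: "prob_space M"
    using alg by (auto simp: det_algorithms_def algorithms_def)
  obtain \<omega>0 where \<omega>0: "\<omega>0 \<in> space M" using prob_space.not_empty[OF M] by blast
  have a_Rn: "a H \<in> Rn d" if "H \<in> histories d" for H
    using a[OF \<omega>0 that] A[OF \<omega>0 that] by simp
  let ?ans = "\<lambda>v. answers a (base v n) (base_grad v n)"
  have "\<exists>v. (\<forall>i. v i \<in> Rn d) \<and> (\<forall>i\<ge>Suc n. v i = 0) \<and> (\<forall>i<Suc n. norm (v i) = 1) \<and>
      (\<forall>i j. i \<noteq> j \<longrightarrow> inner (v i) (v j) = 0) \<and>
      (\<forall>i<Suc n. \<forall>j\<le>i. inner (v i) (a (?ans v j)) = 0)"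
    by (rule resisting_chain) (use a_Rn d in auto)
  then obtain v where v: "\<forall>i. v i \<in> Rn d" "\<forall>i<Suc n. norm (v i) = 1"
    "\<forall>i j. i \<noteq> j \<longrightarrow> inner (v i) (v j) = 0"
    "\<forall>i<Suc n. \<forall>j\<le>i. inner (v i) (a (?ans v j)) = 0"
    by (elim exE conjE) (rule that)
  note v_Rn = v(1)[rule_format] and v1 = v(2)[rule_format, OF le_imp_less_Suc]
    and vo = v(3)[rule_format] and vr = v(4)[rule_format, OF le_imp_less_Suc]
  interpret Rn_chain v n d
  proof
    show "inner (v i) (v j) = (if i = j then 1 else 0)" if "i \<le> n" "j \<le> n" for i j
      using v1[of i] vo[of i j] that by (cases "i = j") (simp_all add: norm_eq_1)
    show "v i \<in> Rn d" for i by (rule v(1)[rule_format])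
  qed
  have hist: "?ans v t \<in> histories d" for t
    by (intro answers_in_histories a_Rn base_grad_Rn v(1)[rule_format])
  let ?h = "hard v n"
  show ?thesis
  proof
    show "Rn_chain v n d" by unfold_locales
    fix \<omega> assume \<omega>: "\<omega> \<in> space M"
    \<comment> \<open>Histories of length at most n suffice, since iterate t is the reply to a
      history of length t - 1.\<close>
    have eq: "answers (A \<omega>) ?h (\<O> ?h) t = ?ans v t" if "t \<le> n" for t
      using that
    proof (induction t)
      case (Suc t)
      define x where "x = a (?ans v t)"
      have x: "A \<omega> (?ans v t) = x" "x \<in> Rn d"
        using a[OF \<omega> hist] a_Rn[OF hist] by (simp_all add: x_def)
      have hid: "inner (v n) x = 0" using vr[of n t] Suc.prems by (simp add: x_def)
      have "\<O> ?h x = base_grad v n x"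
        using \<O> hard_in_class x(2) by (intro clarke_hard hid) (auto simp: oracles_def)
      then show ?case
        using Suc x(1) hard_eq_base[OF hid] by (simp add: Let_def x_def)
    qed simp
    show "far_from_stationary d (1/8) ?h (iter_pt (A \<omega>) ?h (\<O> ?h)) (Suc n)"
    proof (rule far_if_orthogonal)
      fix t assume t: "t \<in> {1..Suc n}"
      then have t': "t - 1 \<le> n" by auto
      show "inner (v n) (iter_pt (A \<omega>) ?h (\<O> ?h) t) = 0"
        using vr[of n "t - 1", OF order_refl t'] eq[OF t'] a[OF \<omega> hist[of "t - 1"]]
        by (simp only: iter_pt_def)
    qed simp
  qed
qed

theorem theorem1:
  "\<exists>C > 0. \<exists>c > 0. \<forall>(T::nat) (d::nat) \<O> M A.
     T > 1 \<longrightarrow> d \<ge> 2 * T \<longrightarrow> \<O> \<in> oracles d \<longrightarrow>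
     (M, A) \<in> det_algorithms d \<union> span_algorithms d \<O> \<longrightarrow>
     (\<exists>h :: rvec \<Rightarrow> real.
        C-lipschitz_on (Rn d) h \<and>
        bdd_below (h ` Rn d) \<and> h 0 - (INF x\<in>Rn d. h x) \<le> C \<and>
        (let far = (\<lambda>\<omega>. (INF x\<in>stationary_points d c h.
               ereal (MIN t\<in>{1..T}. norm (iter_pt (A \<omega>) h (\<O> h) t - x))) \<ge> ereal c)
         in (\<exists>E\<in>sets M. measure M E \<ge> 1 - real T * exp (- c * real d) \<and> (\<forall>\<omega>\<in>E. far \<omega>)) \<and>
            ((M, A) \<in> det_algorithms d \<longrightarrow> (\<forall>\<omega>\<in>space M. far \<omega>))))"
proof (rule exI[of _ 8], intro conjI, simp, rule exI[of _ "1/8"], intro conjI allI impI, simp)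
  fix T d :: nat and \<O> and M :: "(nat \<Rightarrow> real) measure" and A
  assume T: "T > 1" and d: "d \<ge> 2 * T" and \<O>: "\<O> \<in> oracles d"
    and alg: "(M, A) \<in> det_algorithms d \<union> span_algorithms d \<O>"
  \<comment> \<open>The chain \<open>v 0\<close>, ..., \<open>v n\<close> has T vectors, and
    \<open>v n\<close> stays hidden during all T queries.\<close>
  define n where "n = T - 1"
  have Tn: "T = Suc n" and n: "2 * n + 1 < d" using T d by (auto simp: n_def)
  have prob: "prob_space M"
    using alg by (auto simp: det_algorithms_def span_algorithms_def algorithms_def)
  obtain v where v: "Rn_chain v n d"
    and far: "\<And>\<omega>. \<omega> \<in> space M \<Longrightarrow>
      far_from_stationary d (1/8) (hard v n) (iter_pt (A \<omega>) (hard v n) (\<O> (hard v n))) T"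
  proof (cases "(M, A) \<in> det_algorithms d")
    case True
    then show thesis using det_algorithm_far[OF \<O> True n] that unfolding Tn by blast
  next
    case False
    then have span: "(M, A) \<in> span_algorithms d \<O>" using alg by blast
    have "Rn_chain unit_vec n d"
      by unfold_locales (use n in \<open>auto simp: inner_unit_vec unit_vec_Rn\<close>)
    then show thesis using span_algorithm_far[OF \<O> span] n that unfolding Tn by simp
  qed
  interpret Rn_chain v n d by (rule v)
  let ?h = "hard v n"
  define F where "F = (\<lambda>\<omega>. (INF x\<in>stationary_points d (1/8) ?h.
    ereal (MIN t\<in>{1..T}. norm (iter_pt (A \<omega>) ?h (\<O> ?h) t - x))) \<ge> ereal (1/8))"
  have F: "\<forall>\<omega>\<in>space M. F \<omega>"
    using far unfolding F_def far_from_stationary_def by blast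
  have "1 - real T * exp (- (1/8) * real d) \<le> measure M (space M)"
    using prob_space.prob_space[OF prob] by simp
  \<comment> \<open>The event is the whole seed space, of probability 1.\<close>
  with F have E: "\<exists>E\<in>sets M. 1 - real T * exp (- (1/8) * real d) \<le> measure M E \<and> (\<forall>\<omega>\<in>E. F \<omega>)"
    by (intro bexI[of _ "space M"] conjI sets.top)
  show "\<exists>h. 8-lipschitz_on (Rn d) h \<and>
        bdd_below (h ` Rn d) \<and> h 0 - (INF x\<in>Rn d. h x) \<le> 8 \<and>
        (let far = (\<lambda>\<omega>. (INF x\<in>stationary_points d (1/8) h.
               ereal (MIN t\<in>{1..T}. norm (iter_pt (A \<omega>) h (\<O> h) t - x))) \<ge> ereal (1/8))
         in (\<exists>E\<in>sets M. measure M E \<ge> 1 - real T * exp (- (1/8) * real d) \<and> (\<forall>\<omega>\<in>E. far \<omega>)) \<and>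
            ((M, A) \<in> det_algorithms d \<longrightarrow> (\<forall>\<omega>\<in>space M. far \<omega>)))"
    unfolding Let_def
    by (intro exI[of _ ?h] conjI hard_lipschitz_on hard_bdd_below hard_gap
        E[unfolded F_def] impI F[unfolded F_def])
qed

end
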